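(* Let $\Gamma$ be a finite nonabelian group. Then $rc(CG(\Gamma))\leq 3$ if and only if either $\Gamma$ has a nontrivial center, or $\Gamma$ has a trivial center and $\Gamma$ has at most three maximal abelian subgroups of order $2$.
   Context: For a finite group $\Gamma$, the commuting graph $CG(\Gamma)$ is the simple graph with vertex set $\Gamma$ in which two distinct elements $a,b$ are adjacent if and only if $ab=ba$. For a connected graph $G$, an edge coloring (adjacent edges may share colors) makes $G$ rainbow-connected if every two distinct vertices are joined by a path whose edges all have pairwise distinct colors; the rainbow connection number $rc(G)$ is the minimum number of colors in such a coloring. The center of $\Gamma$ is $Z(\Gamma)=\{z\in\Gamma: za=az \text{ for all } a\in\Gamma\}$; it is trivial if it equals $\{e\}$. A maximal abelian subgroup of $\Gamma$ is an abelian subgroup not properly contained in any other abelian subgroup of $\Gamma$. *)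

theory Defs
  imports "HOL-Algebra.Group" "Graph_Theory.Pair_Digraph"
begin

text \<open>
  A simple graph is a loop-free symmetric digraph whose arcs are ordered pairs of vertices
  (locale \<open>pair_graph\<close>), so each undirected edge occurs as two opposite arcs. Colors are
  attached to the unordered edges \<open>{u, v}\<close>, which makes the two arcs of an edge share their color.
\<close>

definition edges :: "'a pair_pre_digraph \<Rightarrow> 'a set set" where
  "edges G = (\<lambda>(u, v). {u, v}) ` parcs G"

definition arc_color :: "('a set \<Rightarrow> nat) \<Rightarrow> 'a \<times> 'a \<Rightarrow> nat" where
  "arc_color c = (\<lambda>(u, v). c {u, v})"

text \<open>\<open>apath u p v\<close>: \<open>p\<close> is the arc list of a walk from \<open>u\<close> to \<open>v\<close> with no repeated vertex.\<close>

definition rainbow_connected :: "'a pair_pre_digraph \<Rightarrow> ('a set \<Rightarrow> nat) \<Rightarrow> bool" where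
  "rainbow_connected G c \<longleftrightarrow>
     (\<forall>u \<in> pverts G. \<forall>v \<in> pverts G. u \<noteq> v \<longrightarrow>
        (\<exists>p. pre_digraph.apath (with_proj G) u p v \<and> distinct (map (arc_color c) p)))"

text \<open>
  Only meaningful for finite connected graphs, for which the set of admissible \<open>k\<close> is nonempty;
  for commuting graphs this is \<open>commuting_graph_rainbow_coloring\<close> below.
\<close>

definition rainbow_connection_number :: "'a pair_pre_digraph \<Rightarrow> nat" where
  "rainbow_connection_number G =
     (LEAST k. \<exists>c. c ` edges G \<subseteq> {..<k} \<and> rainbow_connected G c)"

definition commuting_graph :: "('a, 'b) monoid_scheme \<Rightarrow> 'a pair_pre_digraph" where
  "commuting_graph G =
     \<lparr>pverts = carrier G,
      parcs = {(a, b). a \<in> carrier G \<and> b \<in> carrier G \<and> a \<noteq> b \<and> a \<otimes>\<^bsub>G\<^esub> b = b \<otimes>\<^bsub>G\<^esub> a}\<rparr>"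

definition group_center :: "('a, 'b) monoid_scheme \<Rightarrow> 'a set" where
  "group_center G = {z \<in> carrier G. \<forall>a \<in> carrier G. z \<otimes>\<^bsub>G\<^esub> a = a \<otimes>\<^bsub>G\<^esub> z}"

definition abelian_subgroup_of :: "'a set \<Rightarrow> ('a, 'b) monoid_scheme \<Rightarrow> bool" where
  "abelian_subgroup_of H G \<longleftrightarrow> subgroup H G \<and> comm_group (G\<lparr>carrier := H\<rparr>)"

definition maximal_abelian_subgroup :: "'a set \<Rightarrow> ('a, 'b) monoid_scheme \<Rightarrow> bool" where
  "maximal_abelian_subgroup H G \<longleftrightarrow>
     abelian_subgroup_of H G \<and> \<not> (\<exists>K. abelian_subgroup_of K G \<and> H \<subset> K)"

lemma commuting_graph_is_graph:
  assumes "finite (carrier G)"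
  shows "pair_graph (commuting_graph G)"
proof -
  have "parcs (commuting_graph G) \<subseteq> carrier G \<times> carrier G"
    by (auto simp: commuting_graph_def)
  then have "finite (parcs (commuting_graph G))"
    using assms finite_subset by blast
  then show ?thesis
    using assms
    by unfold_locales (auto simp: commuting_graph_def symmetric_def arcs_ends_def arc_to_ends_def sym_def)
qed

lemma commuting_graph_rainbow_coloring:
  assumes "group G" and fin: "finite (carrier G)"
  shows "\<exists>k c. c ` edges (commuting_graph G) \<subseteq> {..<k} \<and> rainbow_connected (commuting_graph G) c"
proof -
  interpret group G by fact
  let ?\<Gamma> = "commuting_graph G"
  interpret pair_graph ?\<Gamma> by (rule commuting_graph_is_graph) (rule fin)
  have "finite (edges ?\<Gamma>)"
    unfolding edges_def by (rule finite_imageI) simp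
  then obtain c :: "'a set \<Rightarrow> nat" and k where im: "c ` edges ?\<Gamma> = {..<k}" and inj: "inj_on c (edges ?\<Gamma>)"
    using finite_imp_inj_to_nat_seg[of "edges ?\<Gamma>"] by (metis lessThan_def)
  have to_one: "(a, \<one>\<^bsub>G\<^esub>) \<in> parcs ?\<Gamma>" "(\<one>\<^bsub>G\<^esub>, a) \<in> parcs ?\<Gamma>" "{a, \<one>\<^bsub>G\<^esub>} \<in> edges ?\<Gamma>" "{\<one>\<^bsub>G\<^esub>, a} \<in> edges ?\<Gamma>"
    if "a \<in> carrier G" "a \<noteq> \<one>\<^bsub>G\<^esub>" for a
    using that by (force simp: commuting_graph_def edges_def)+
  have verts: "pverts ?\<Gamma> = carrier G"
    by (simp add: commuting_graph_def)
  have "\<exists>p. apath u p v \<and> distinct (map (arc_color c) p)"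
    if uv: "u \<in> carrier G" "v \<in> carrier G" "u \<noteq> v" for u v
  proof (cases "u = \<one>\<^bsub>G\<^esub> \<or> v = \<one>\<^bsub>G\<^esub>")
    case True
    then have "(u, v) \<in> parcs ?\<Gamma>" using uv to_one by auto
    then have "apath u [(u, v)] v"
      using uv verts by (auto simp: apath_def awalk_def)
    then show ?thesis by (intro exI[of _ "[(u, v)]"]) simp
  next
    case False
    then have "apath u [(u, \<one>\<^bsub>G\<^esub>), (\<one>\<^bsub>G\<^esub>, v)] v"
      using uv verts to_one by (auto simp: apath_def awalk_def)
    moreover have "c {u, \<one>\<^bsub>G\<^esub>} \<noteq> c {\<one>\<^bsub>G\<^esub>, v}"
      using inj_onD[OF inj, of "{u, \<one>\<^bsub>G\<^esub>}" "{\<one>\<^bsub>G\<^esub>, v}"] to_one uv False by (auto simp: doubleton_eq_iff)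
    ultimately show ?thesis
      by (intro exI[of _ "[(u, \<one>\<^bsub>G\<^esub>), (\<one>\<^bsub>G\<^esub>, v)]"]) (simp add: arc_color_def)
  qed
  then have "rainbow_connected ?\<Gamma> c"
    unfolding rainbow_connected_def verts by blast
  with im show ?thesis by blast
qed

end

theory Submission
  imports Defs
begin

text \<open>
  A nonidentity element \<open>t\<close> is adjacent to \<open>\<one>\<close> only if and only if \<open>{\<one>, t}\<close> is a maximal abelian
  subgroup. The edges from \<open>\<one>\<close> to such pendant vertices need pairwise distinct colors, whence at
  most three of them if three colors suffice.

  Conversely, if \<open>z \<noteq> \<one>\<close> is central, then color the edges at \<open>\<one>\<close> by 0, those at \<open>z\<close> by 1,
  and \<open>{\<one>, z}\<close> by 2, so that every path \<open>x, \<one>, z, y\<close> is rainbow. If there are at most three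
  pendant vertices, give their edges distinct colors. On the remaining nonidentity vertices choose a
  maximal independent set \<open>X\<close>. Then each vertex in \<open>X\<close> has a neighbor outside \<open>X\<close> and
  conversely. Color the edges from \<open>\<one>\<close> to \<open>X\<close> by 0, those from \<open>\<one>\<close> to the complement by 1,
  and all edges avoiding \<open>\<one>\<close> by 2.
\<close>

section \<open>Rainbow colorings of graphs with a universal vertex\<close>

definition pendants :: "'a pair_pre_digraph \<Rightarrow> 'a \<Rightarrow> 'a set" where
  "pendants G e = {v \<in> pverts G. \<forall>w. (v, w) \<in> parcs G \<longleftrightarrow> w = e}"

context pair_graph
begin

section \<open>Short rainbow paths and the obstruction from pendant vertices\<close>

lemma parcs_commute: "(u, v) \<in> parcs G \<longleftrightarrow> (v, u) \<in> parcs G"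
  using arcs_symmetric by blast

lemma parcs_in_pverts: "(u, v) \<in> parcs G \<Longrightarrow> u \<in> pverts G \<and> v \<in> pverts G"
  using in_arcsD1 in_arcsD2 by auto

lemma rainbow_path_1:
  assumes "(u, v) \<in> parcs G"
  shows "\<exists>p. apath u p v \<and> distinct (map (arc_color c) p)"
proof -
  have "u \<noteq> v" "u \<in> pverts G" "v \<in> pverts G"
    using assms no_loops' parcs_in_pverts by blast+
  then have "apath u [(u, v)] v"
    using assms by (auto simp: apath_def awalk_def)
  then show ?thesis by (intro exI[of _ "[(u, v)]"]) simp
qed

lemma rainbow_path_2:
  assumes "(u, x) \<in> parcs G" "(x, v) \<in> parcs G" "u \<noteq> v" "c {u, x} \<noteq> c {x, v}"
  shows "\<exists>p. apath u p v \<and> distinct (map (arc_color c) p)"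
proof -
  have "u \<noteq> x" "x \<noteq> v" "u \<in> pverts G" "v \<in> pverts G" "x \<in> pverts G"
    using assms no_loops' parcs_in_pverts by blast+
  then have "apath u [(u, x), (x, v)] v"
    using assms by (auto simp: apath_def awalk_def)
  then show ?thesis
    using assms by (intro exI[of _ "[(u, x), (x, v)]"]) (simp add: arc_color_def)
qed

text \<open>Adjacent vertices differ because there are no loops, so only the three nonadjacent pairs
  on the path need explicit inequalities.\<close>

lemma rainbow_path_3:
  assumes "(u, x) \<in> parcs G" "(x, y) \<in> parcs G" "(y, v) \<in> parcs G"
    and "u \<noteq> v" "u \<noteq> y" "x \<noteq> v"
    and "distinct [c {u, x}, c {x, y}, c {y, v}]"
  shows "\<exists>p. apath u p v \<and> distinct (map (arc_color c) p)"
proof -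
  have "u \<noteq> x" "x \<noteq> y" "y \<noteq> v" "u \<in> pverts G" "v \<in> pverts G" "x \<in> pverts G" "y \<in> pverts G"
    using assms no_loops' parcs_in_pverts by blast+
  then have "apath u [(u, x), (x, y), (y, v)] v"
    using assms by (auto simp: apath_def awalk_def)
  then show ?thesis
    using assms by (intro exI[of _ "[(u, x), (x, y), (y, v)]"]) (simp add: arc_color_def)
qed

text \<open>A path between two pendants must leave the first through \<open>e\<close> and enter the
  second from \<open>e\<close>. Hence a rainbow coloring is injective on the pendant edges.\<close>

lemma card_pendants_le:
  assumes col: "c ` edges G \<subseteq> {..<k}" and rc: "rainbow_connected G c"
  shows "card (pendants G e) \<le> k"
proof -
  have arc: "(v, e) \<in> parcs G" "(e, v) \<in> parcs G" if "v \<in> pendants G e" for v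
    using that parcs_commute unfolding pendants_def by auto
  have "inj_on (\<lambda>v. c {v, e}) (pendants G e)"
  proof (rule inj_onI, rule ccontr)
    fix u v
    assume u: "u \<in> pendants G e" and v: "v \<in> pendants G e"
      and eq: "c {u, e} = c {v, e}" and ne: "u \<noteq> v"
    have "u \<in> pverts G" "v \<in> pverts G" using u v by (auto simp: pendants_def)
    then obtain p where p: "apath u p v" "distinct (map (arc_color c) p)"
      using rc ne unfolding rainbow_connected_def by blast
    then have walk: "awalk u p v" by (simp add: apath_def)
    have nonempty: "p \<noteq> []" using walk ne by (auto simp: awalk_def)
    have "fst (hd p) = u"
      using walk nonempty by (cases p) (auto simp: awalk_def)
    moreover have "snd (last p) = v"
      using walk nonempty awlast_if_cas[of u p v]
      by (cases p rule: rev_cases) (auto simp: awalk_def cas_append_iff)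
    moreover have "hd p \<in> parcs G" "last p \<in> parcs G"
      using walk nonempty by (auto simp: awalk_def)
    ultimately have "(u, snd (hd p)) \<in> parcs G" "(fst (last p), v) \<in> parcs G"
      by (metis prod.collapse)+
    then have "snd (hd p) = e" "fst (last p) = e"
      using u v parcs_commute unfolding pendants_def by auto
    then have "hd p = (u, e)" "last p = (e, v)"
      using \<open>fst (hd p) = u\<close> \<open>snd (last p) = v\<close> by (auto simp: prod_eq_iff)
    then have "(u, e) \<in> set p" "(e, v) \<in> set p"
      using nonempty hd_in_set last_in_set by metis+
    moreover have "arc_color c (u, e) = arc_color c (e, v)"
      using eq by (simp add: arc_color_def insert_commute)
    \<comment> \<open>Two arcs of a rainbow path with equal color coincide, which here forces
      \<open>u = e = v\<close>.\<close>
    ultimately have "(u, e) = (e, v)"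
      using p(2) by (metis distinct_map inj_onD)
    with ne show False by simp
  qed
  moreover have "(\<lambda>v. c {v, e}) ` pendants G e \<subseteq> {..<k}"
    using col arc unfolding edges_def by force
  ultimately show ?thesis
    using card_inj_on_le[of _ "pendants G e" "{..<k}"] by simp
qed

section \<open>Explicit colorings with three colors\<close>

lemma rainbow_coloring_two_universal:
  assumes e: "e \<in> pverts G" "\<And>v. v \<in> pverts G \<Longrightarrow> v \<noteq> e \<Longrightarrow> (e, v) \<in> parcs G"
    and z: "z \<in> pverts G" "\<And>v. v \<in> pverts G \<Longrightarrow> v \<noteq> z \<Longrightarrow> (z, v) \<in> parcs G"
    and "e \<noteq> z"
  shows "\<exists>c. c ` edges G \<subseteq> {..<3} \<and> rainbow_connected G c"
proof -
  \<comment> \<open>The path \<open>u, e, z, v\<close> receives the colors 0, 2, 1. Edges avoiding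
    both \<open>e\<close> and \<open>z\<close> also get 1, but the paths chosen below never use
    them.\<close>
  define c :: "'a set \<Rightarrow> nat" where
    "c = (\<lambda>s. if e \<in> s then if z \<in> s then 2 else 0 else 1)"
  have "rainbow_connected G c"
    unfolding rainbow_connected_def
  proof (intro ballI impI)
    fix u v assume uv: "u \<in> pverts G" "v \<in> pverts G" "u \<noteq> v"
    show "\<exists>p. apath u p v \<and> distinct (map (arc_color c) p)"
    proof (cases "{u, v} \<inter> {e, z} = {}")
      case True
      then show ?thesis
        using uv e z \<open>e \<noteq> z\<close> parcs_commute
        by (intro rainbow_path_3[of u e z v c]) (auto simp: c_def)
    next
      case False
      then have "(u, v) \<in> parcs G" using uv e z parcs_commute by blast
      then show ?thesis by (rule rainbow_path_1)
    qed
  qed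
  moreover have "c ` edges G \<subseteq> {..<3}" by (auto simp: c_def)
  ultimately show ?thesis by blast
qed

lemma ex_complementary_dominating_set:
  assumes "finite V" and nbr: "\<And>v. v \<in> V \<Longrightarrow> \<exists>w \<in> V. (v, w) \<in> parcs G"
  obtains X where "X \<subseteq> V" "\<And>v. v \<in> V \<Longrightarrow> \<exists>w \<in> V. (v, w) \<in> parcs G \<and> (w \<in> X \<longleftrightarrow> v \<notin> X)"
proof -
  define \<I> where "\<I> = {X. X \<subseteq> V \<and> (\<forall>x \<in> X. \<forall>y \<in> X. (x, y) \<notin> parcs G)}"
  have "finite \<I>" using \<open>finite V\<close> by (simp add: \<I>_def)
  moreover have "{} \<in> \<I>" by (simp add: \<I>_def)
  ultimately obtain X where X: "X \<in> \<I>" and max: "\<And>Y. Y \<in> \<I> \<Longrightarrow> X \<subseteq> Y \<Longrightarrow> X = Y"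
    using finite_has_maximal[of \<I>] by blast
  have "\<exists>w \<in> V. (v, w) \<in> parcs G \<and> (w \<in> X \<longleftrightarrow> v \<notin> X)" if v: "v \<in> V" for v
  proof (cases "v \<in> X")
    case True
    then show ?thesis using nbr[OF v] X unfolding \<I>_def by blast
  next
    case False
    \<comment> \<open>Since \<open>X\<close> is independent and there are no loops, an arc spoiling
      independence of \<open>insert v X\<close> must join \<open>v\<close> to
      \<open>X\<close>.\<close>
    then have "insert v X \<notin> \<I>" using max[of "insert v X"] by blast
    then obtain w where "w \<in> X" "(v, w) \<in> parcs G"
      using X v no_loops' parcs_commute unfolding \<I>_def by blast
    then show ?thesis using X False unfolding \<I>_def by blast
  qed
  then show ?thesis using X that unfolding \<I>_def by blast
qed

text \<open>Vertices with different values of \<open>f\<close> are joined through \<open>e\<close>.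
  If the values agree and \<open>v\<close> is in \<open>V\<close>, a detour
  \<open>u, e, w, v\<close> through a neighbor \<open>w\<close> of \<open>v\<close> with the other
  value in {0, 1} is rainbow, its last edge having color 2.\<close>

lemma rainbow_coloring_few_pendants:
  assumes e: "e \<in> pverts G" "\<And>v. v \<in> pverts G \<Longrightarrow> v \<noteq> e \<Longrightarrow> (e, v) \<in> parcs G"
    and few: "card (pendants G e) \<le> 3"
  shows "\<exists>c. c ` edges G \<subseteq> {..<3} \<and> rainbow_connected G c"
proof -
  let ?T = "pendants G e"
  define V where "V = pverts G - {e} - ?T"
  have finT: "finite ?T" by (simp add: pendants_def)
  have finV: "finite V" by (simp add: V_def)
  have arc: "(e, v) \<in> parcs G" "(v, e) \<in> parcs G" if "v \<in> pverts G" "v \<noteq> e" for v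
    using e that parcs_commute by auto
  have "\<exists>w \<in> V. (v, w) \<in> parcs G" if v: "v \<in> V" for v
  proof -
    obtain w where w: "(v, w) \<in> parcs G" "w \<noteq> e"
      using v arc unfolding V_def pendants_def by blast
    then have "w \<in> pverts G" using parcs_in_pverts by blast
    \<comment> \<open>A pendant has \<open>e\<close> as its only neighbor, whereas \<open>w\<close>
      is adjacent to \<open>v\<close>.\<close>
    moreover have "w \<notin> ?T" using w v parcs_commute unfolding V_def pendants_def by auto
    ultimately show ?thesis using w unfolding V_def by blast
  qed
  then obtain X where X: "X \<subseteq> V"
    "\<And>v. v \<in> V \<Longrightarrow> \<exists>w \<in> V. (v, w) \<in> parcs G \<and> (w \<in> X \<longleftrightarrow> v \<notin> X)"
    using ex_complementary_dominating_set[OF finV] by blast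
  obtain g :: "'a \<Rightarrow> nat" where g: "g ` ?T \<subseteq> {..<3}" "inj_on g ?T"
    using card_le_inj[OF finT, of "{..<3::nat}"] few by auto
  define f where "f v = (if v \<in> ?T then g v else if v \<in> X then 0 else 1)" for v
  have f3: "f v < 3" for v using g by (auto simp: f_def)
  \<comment> \<open>For an edge at \<open>e\<close>, \<open>the_elem (s - {e})\<close> is its other
    end.\<close>
  define c where "c s = (if e \<in> s then f (the_elem (s - {e})) else 2)" for s
  have c_e: "c {v, e} = f v" "c {e, v} = f v" if "v \<noteq> e" for v
    using that by (auto simp: c_def insert_Diff_if)
  have c_ne: "c {v, w} = 2" if "v \<noteq> e" "w \<noteq> e" for v w
    using that by (auto simp: c_def)
  have partner: "\<exists>w. (v, w) \<in> parcs G \<and> w \<in> pverts G \<and> w \<noteq> e \<and> f w \<noteq> f v \<and> f w < 2"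
    if "v \<in> V" for v
    using X(2)[OF that] that by (fastforce simp: f_def V_def)
  have f2: "f v < 2" if "v \<in> V" for v
    using that by (auto simp: f_def V_def)
  have "rainbow_connected G c"
    unfolding rainbow_connected_def
  proof (intro ballI impI)
    fix u v assume uv: "u \<in> pverts G" "v \<in> pverts G" "u \<noteq> v"
    \<comment> \<open>A vertex other than \<open>e\<close> and outside \<open>V\<close> is a
      pendant, so the cases are exhaustive. The third and fourth mirror each other, and the last
      contradicts injectivity of \<open>g\<close>.\<close>
    consider "u = e \<or> v = e" | "u \<noteq> e" "v \<noteq> e" "f u \<noteq> f v" | "f u = f v" "u \<noteq> e" "v \<in> V"
      | "f u = f v" "v \<noteq> e" "u \<in> V" | "u \<in> ?T" "v \<in> ?T" "f u = f v"
      using uv unfolding V_def by blast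
    then show "\<exists>p. apath u p v \<and> distinct (map (arc_color c) p)"
    proof cases
      case 1
      then have "(u, v) \<in> parcs G" using uv arc by blast
      then show ?thesis by (rule rainbow_path_1)
    next
      case 2
      then show ?thesis
        using uv arc by (intro rainbow_path_2[of u e v c]) (auto simp: c_e)
    next
      case 3
      then obtain w where w: "(v, w) \<in> parcs G" "w \<in> pverts G" "w \<noteq> e" "f w \<noteq> f v" "f w < 2"
        using partner by blast
      have "v \<noteq> e" using 3 V_def by auto
      then show ?thesis
        using uv arc 3 w f2[of v] parcs_commute
        by (intro rainbow_path_3[of u e w v c]) (auto simp: c_e c_ne)
    next
      case 4
      then obtain w where w: "(u, w) \<in> parcs G" "w \<in> pverts G" "w \<noteq> e" "f w \<noteq> f u" "f w < 2"
        using partner by blast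
      have "u \<noteq> e" using 4 V_def by auto
      then show ?thesis
        using uv arc 4 w f2[of u] parcs_commute
        by (intro rainbow_path_3[of u w e v c]) (auto simp: c_e c_ne)
    next
      case 5
      then show ?thesis using g(2) uv by (auto simp: f_def dest: inj_onD)
    qed
  qed
  moreover have "c ` edges G \<subseteq> {..<3}" using f3 by (auto simp: c_def)
  ultimately show ?thesis by blast
qed

end

section \<open>Maximal abelian subgroups of order two\<close>

definition centralizer :: "('a, 'b) monoid_scheme \<Rightarrow> 'a set \<Rightarrow> 'a set" where
  "centralizer G S = {x \<in> carrier G. \<forall>s \<in> S. x \<otimes>\<^bsub>G\<^esub> s = s \<otimes>\<^bsub>G\<^esub> x}"

context group
begin

section \<open>Centralizers and maximal abelian subgroups\<close>

lemma subgroup_centralizer: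
  assumes "S \<subseteq> carrier G"
  shows "subgroup (centralizer G S) G"
proof (rule subgroupI)
  show "centralizer G S \<noteq> {}"
    using assms by (auto simp: centralizer_def intro!: exI[of _ \<one>])
next
  fix a assume a: "a \<in> centralizer G S"
  have "inv a \<otimes> s = s \<otimes> inv a" if "s \<in> S" for s
  proof -
    have "a \<in> carrier G" "s \<in> carrier G" "a \<otimes> s = s \<otimes> a"
      using that assms a by (auto simp: centralizer_def)
    then show ?thesis by (metis inv_closed inv_solve_left inv_solve_right m_assoc m_closed)
  qed
  then show "inv a \<in> centralizer G S" using a by (auto simp: centralizer_def)
next
  fix a b assume "a \<in> centralizer G S" "b \<in> centralizer G S"
  then have ab: "a \<in> carrier G" "b \<in> carrier G"
    "\<And>s. s \<in> S \<Longrightarrow> a \<otimes> s = s \<otimes> a" "\<And>s. s \<in> S \<Longrightarrow> b \<otimes> s = s \<otimes> b"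
    by (auto simp: centralizer_def)
  have "a \<otimes> b \<otimes> s = s \<otimes> (a \<otimes> b)" if "s \<in> S" for s
  proof -
    have s: "s \<in> carrier G" using that assms by blast
    have "a \<otimes> b \<otimes> s = a \<otimes> s \<otimes> b" using ab(1,2) ab(4)[OF that] s by (metis m_assoc)
    also have "\<dots> = s \<otimes> (a \<otimes> b)" using ab s that by (simp add: m_assoc[symmetric])
    finally show ?thesis .
  qed
  then show "a \<otimes> b \<in> centralizer G S" using ab by (auto simp: centralizer_def)
qed (auto simp: centralizer_def)

lemma abelian_subgroup_of_iff:
  "abelian_subgroup_of H G \<longleftrightarrow> subgroup H G \<and> (\<forall>x \<in> H. \<forall>y \<in> H. x \<otimes> y = y \<otimes> x)"
proof -
  have "comm_group (G\<lparr>carrier := H\<rparr>)"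
    if "subgroup H G" "\<forall>x \<in> H. \<forall>y \<in> H. x \<otimes> y = y \<otimes> x"
    using that subgroup.subgroup_is_group[OF that(1) is_group]
    by (intro group.group_comm_groupI) auto
  moreover have "x \<otimes> y = y \<otimes> x"
    if "comm_group (G\<lparr>carrier := H\<rparr>)" "x \<in> H" "y \<in> H" for x y
  proof -
    interpret H: comm_group "G\<lparr>carrier := H\<rparr>" by fact
    show ?thesis using H.m_comm[of x y] that by simp
  qed
  ultimately show ?thesis unfolding abelian_subgroup_of_def by blast
qed

text \<open>The double centralizer works: \<open>S\<close> lies in its own centralizer
  \<open>C\<close>, so the centralizer of \<open>C\<close> lies in \<open>C\<close> and is therefore
  commutative.\<close>

lemma ex_abelian_subgroup_superset:
  assumes S: "S \<subseteq> carrier G" and comm: "\<And>x y. x \<in> S \<Longrightarrow> y \<in> S \<Longrightarrow> x \<otimes> y = y \<otimes> x"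
  shows "\<exists>K. abelian_subgroup_of K G \<and> S \<subseteq> K"
proof -
  let ?C = "centralizer G S"
  let ?K = "centralizer G ?C"
  have "?C \<subseteq> carrier G" by (auto simp: centralizer_def)
  then have "subgroup ?K G" by (rule subgroup_centralizer)
  moreover have "S \<subseteq> ?C" "S \<subseteq> ?K" using S comm by (auto simp: centralizer_def)
  moreover have "?K \<subseteq> ?C" using \<open>S \<subseteq> ?C\<close> by (auto simp: centralizer_def)
  then have "\<forall>x \<in> ?K. \<forall>y \<in> ?K. x \<otimes> y = y \<otimes> x" by (auto simp: centralizer_def)
  ultimately show ?thesis unfolding abelian_subgroup_of_iff by blast
qed

text \<open>An element centralizing an abelian \<open>H\<close> can be adjoined to \<open>H\<close>
  within an abelian subgroup, so maximality puts it in \<open>H\<close>. Conversely, every abelian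
  subgroup containing \<open>H\<close> centralizes \<open>H\<close>.\<close>

lemma maximal_abelian_subgroup_iff:
  "maximal_abelian_subgroup H G \<longleftrightarrow> subgroup H G \<and> centralizer G H = H"
proof
  assume max: "maximal_abelian_subgroup H G"
  then have H: "subgroup H G" "\<And>x y. x \<in> H \<Longrightarrow> y \<in> H \<Longrightarrow> x \<otimes> y = y \<otimes> x"
    unfolding maximal_abelian_subgroup_def abelian_subgroup_of_iff by blast+
  have sub: "H \<subseteq> carrier G" using H(1) by (rule subgroup.subset)
  have "x \<in> H" if x: "x \<in> centralizer G H" for x
  proof -
    have "\<exists>K. abelian_subgroup_of K G \<and> insert x H \<subseteq> K"
      using x sub H(2) by (intro ex_abelian_subgroup_superset) (auto simp: centralizer_def)
    then show ?thesis using max unfolding maximal_abelian_subgroup_def by blast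
  qed
  moreover have "H \<subseteq> centralizer G H" using sub H(2) by (auto simp: centralizer_def)
  ultimately show "subgroup H G \<and> centralizer G H = H" using H by blast
next
  assume H: "subgroup H G \<and> centralizer G H = H"
  then have "\<forall>x \<in> H. \<forall>y \<in> H. x \<otimes> y = y \<otimes> x" by (auto simp: centralizer_def)
  moreover have "K \<subseteq> H" if K: "abelian_subgroup_of K G" "H \<subseteq> K" for K
  proof -
    have "K \<subseteq> carrier G" "\<forall>x \<in> K. \<forall>y \<in> K. x \<otimes> y = y \<otimes> x"
      using K(1) subgroup.subset unfolding abelian_subgroup_of_iff by blast+
    then have "K \<subseteq> centralizer G H" using K(2) by (auto simp: centralizer_def)
    then show ?thesis using H by simp
  qed
  ultimately show "maximal_abelian_subgroup H G"
    using H unfolding maximal_abelian_subgroup_def abelian_subgroup_of_iff[of H] by blast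
qed

section \<open>Pendant vertices of the commuting graph\<close>

lemma mem_pendants_commuting_graph_iff:
  "t \<in> pendants (commuting_graph G) \<one> \<longleftrightarrow>
     t \<in> carrier G \<and> t \<noteq> \<one> \<and> centralizer G {t} = {\<one>, t}"
proof (cases "t \<in> carrier G")
  case True
  have arc: "(t, w) \<in> parcs (commuting_graph G) \<longleftrightarrow> w \<in> centralizer G {t} \<and> w \<noteq> t" for w
    using True by (auto simp: commuting_graph_def centralizer_def)
  have "t \<in> centralizer G {t}" "\<one> \<in> centralizer G {t}"
    using True by (auto simp: centralizer_def)
  then have "(\<forall>w. w \<in> centralizer G {t} \<and> w \<noteq> t \<longleftrightarrow> w = \<one>) \<longleftrightarrow>
      t \<noteq> \<one> \<and> centralizer G {t} = {\<one>, t}"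
    by blast
  then show ?thesis
    using True unfolding pendants_def mem_Collect_eq arc by (simp add: commuting_graph_def)
next
  case False
  then show ?thesis by (simp add: pendants_def commuting_graph_def)
qed

lemma maximal_abelian_subgroups_order_2:
  "{H. maximal_abelian_subgroup H G \<and> card H = 2} =
     (\<lambda>t. {\<one>, t}) ` pendants (commuting_graph G) \<one>"
proof -
  have cent: "centralizer G {\<one>, t} = centralizer G {t}" for t
    by (auto simp: centralizer_def)
  have "H \<in> (\<lambda>t. {\<one>, t}) ` pendants (commuting_graph G) \<one>"
    if H: "subgroup H G" "centralizer G H = H" "card H = 2" for H
  proof -
    have "\<one> \<in> H" using H(1) by (rule subgroup.one_closed)
    then obtain t where t: "H = {\<one>, t}" "t \<noteq> \<one>"
      using H(3) unfolding card_2_iff by auto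
    then have "t \<in> carrier G" using H(1) subgroup.subset by blast
    then have "t \<in> pendants (commuting_graph G) \<one>"
      using t H(2) cent by (simp add: mem_pendants_commuting_graph_iff)
    then show ?thesis using t by blast
  qed
  \<comment> \<open>The set \<open>{\<one>, t}\<close> is a subgroup because it equals the
    centralizer of \<open>t\<close>.\<close>
  moreover have "subgroup {\<one>, t} G" "centralizer G {\<one>, t} = {\<one>, t}" "card {\<one>, t} = 2"
    if "t \<in> pendants (commuting_graph G) \<one>" for t
    using that subgroup_centralizer[of "{t}"] cent[of t]
    by (auto simp: mem_pendants_commuting_graph_iff)
  ultimately show ?thesis unfolding maximal_abelian_subgroup_iff by blast
qed

lemma card_maximal_abelian_subgroups_order_2:
  "card {H. maximal_abelian_subgroup H G \<and> card H = 2} = card (pendants (commuting_graph G) \<one>)"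
proof -
  have "inj_on (\<lambda>t. {\<one>, t}) (pendants (commuting_graph G) \<one>)"
    by (auto simp: inj_on_def doubleton_eq_iff)
  then show ?thesis
    unfolding maximal_abelian_subgroups_order_2 by (rule card_image)
qed

end

section \<open>From colorings to the rainbow connection number\<close>

lemma rainbow_connection_number_le_iff:
  assumes "\<exists>k c. c ` edges G \<subseteq> {..<k} \<and> rainbow_connected G c"
  shows "rainbow_connection_number G \<le> n \<longleftrightarrow>
    (\<exists>c. c ` edges G \<subseteq> {..<n} \<and> rainbow_connected G c)"
proof
  assume le: "rainbow_connection_number G \<le> n"
  \<comment> \<open>Some admissible number of colors exists, so \<open>LEAST\<close> is attained;
    enlarging the palette to \<open>n\<close> keeps the coloring admissible.\<close>
  obtain c where "c ` edges G \<subseteq> {..<rainbow_connection_number G}" "rainbow_connected G c"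
    using LeastI_ex[OF assms] unfolding rainbow_connection_number_def by blast
  moreover from this le have "c ` edges G \<subseteq> {..<n}"
    by (meson lessThan_subset_iff order_trans)
  ultimately show "\<exists>c. c ` edges G \<subseteq> {..<n} \<and> rainbow_connected G c" by blast
next
  assume "\<exists>c. c ` edges G \<subseteq> {..<n} \<and> rainbow_connected G c"
  then show "rainbow_connection_number G \<le> n"
    unfolding rainbow_connection_number_def by (rule Least_le)
qed

theorem theorem3:
  fixes G :: "('a, 'b) monoid_scheme"
  assumes "group G"
    and "finite (carrier G)"
    and "\<not> comm_group G"
  shows "rainbow_connection_number (commuting_graph G) \<le> 3 \<longleftrightarrow>
    group_center G \<noteq> {\<one>\<^bsub>G\<^esub>} \<or>
    (group_center G = {\<one>\<^bsub>G\<^esub>} \<and>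
     card {H. maximal_abelian_subgroup H G \<and> card H = 2} \<le> 3)"
proof -
  interpret group G by fact
  let ?\<Gamma> = "commuting_graph G"
  interpret \<Gamma>: pair_graph ?\<Gamma> by (rule commuting_graph_is_graph) fact
  \<comment> \<open>Central elements are universal vertices: \<open>\<one>\<close> is always one,
    and a nontrivial center supplies a second.\<close>
  have universal: "z \<in> pverts ?\<Gamma>" "\<And>v. v \<in> pverts ?\<Gamma> \<Longrightarrow> v \<noteq> z \<Longrightarrow> (z, v) \<in> parcs ?\<Gamma>"
    if "z \<in> group_center G" for z
    using that by (auto simp: group_center_def commuting_graph_def)
  have one: "\<one>\<^bsub>G\<^esub> \<in> group_center G" by (auto simp: group_center_def)
  have "\<exists>c. c ` edges ?\<Gamma> \<subseteq> {..<3} \<and> rainbow_connected ?\<Gamma> c"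
    if nontrivial: "group_center G \<noteq> {\<one>\<^bsub>G\<^esub>}"
  proof -
    obtain z where "z \<in> group_center G" "\<one>\<^bsub>G\<^esub> \<noteq> z" using nontrivial one by blast
    then show ?thesis
      using \<Gamma>.rainbow_coloring_two_universal[OF universal[OF one] universal[of z]] by blast
  qed
  moreover have "\<exists>c. c ` edges ?\<Gamma> \<subseteq> {..<3} \<and> rainbow_connected ?\<Gamma> c"
    if "card (pendants ?\<Gamma> \<one>\<^bsub>G\<^esub>) \<le> 3"
    using \<Gamma>.rainbow_coloring_few_pendants[OF universal[OF one]] that by blast
  \<comment> \<open>This gives the forward direction, after a split on whether the center is
    trivial.\<close>
  moreover have "card (pendants ?\<Gamma> \<one>\<^bsub>G\<^esub>) \<le> 3"
    if "\<exists>c. c ` edges ?\<Gamma> \<subseteq> {..<3} \<and> rainbow_connected ?\<Gamma> c"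
    using that \<Gamma>.card_pendants_le by blast
  ultimately show ?thesis
    unfolding rainbow_connection_number_le_iff[OF commuting_graph_rainbow_coloring[OF assms(1,2)]]
      card_maximal_abelian_subgroups_order_2
    by blast
qed

end
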